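(* Let $A$ be a C$^*$-algebra. If $A$ is purely infinite as a ring (algebraic sense), then $A$ is purely infinite in the C$^*$-algebraic sense of Kirchberg and Rørdam.
   Context: C$^*$-algebras are not necessarily unital. For $a\in A$, $AaA$ denotes the set of finite sums $\sum_i r_ias_i$ with $r_i,s_i\in A$, and $\overline{AaA}$ its norm closure. Algebraic sense: a ring $R$ is purely infinite if (i) no quotient of $R$ is a division ring, and (ii) whenever $a\in R$ and $b\in RaR$ (finite sums $\sum_i r_ias_i$ with $r_i,s_i\in R$), there exist $x,y\in R$ with $b=xay$. C$^*$-algebraic sense: for positive elements $a,b\in A_+$, write $b\precsim a$ if there is a sequence of elements $x_i\in A$ such that $x_iax_i^*\to b$ in norm. $A$ is purely infinite in the sense of Kirchberg and Rørdam if (i) there are no characters on $A$, that is, no nonzero homomorphisms $A\to\mathbb{C}$; and (ii) for every $a,b\in A_+$, $b\precsim a$ if and only if $b\in\overline{AaA}$. *)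

theory Defs
  imports "HOL-Analysis.Analysis" "HOL-Algebra.QuotRing"
begin

section \<open>Purely infinite rings\<close>

text \<open>
  Rings are types of the class \<^class>\<open>ring\<close>: associative, not necessarily commutative and not
  necessarily unital.
\<close>

definition two_sided_ideal :: "'a::ring set \<Rightarrow> bool" where
  "two_sided_ideal I \<longleftrightarrow>
     0 \<in> I \<and> (\<forall>x\<in>I. \<forall>y\<in>I. x - y \<in> I) \<and> (\<forall>x\<in>I. \<forall>r. r * x \<in> I \<and> x * r \<in> I)"

text \<open>
  \<^const>\<open>FactRing\<close> is used for the quotient construction, but its records carry a unit, which
  the given ring need not have. The unit field is therefore filled with a parameter \<open>e\<close>; only the
  coset of \<open>e\<close> matters in the quotient. A quotient by \<open>I\<close> is a division ring iff it is one for some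
  choice of \<open>e\<close>.
\<close>

definition ring_record :: "'a::ring \<Rightarrow> 'a Ring.ring" where
  "ring_record e = \<lparr>carrier = UNIV, mult = (*), one = e, zero = 0, add = (+)\<rparr>"

text \<open>The zero ring is not a division ring, since there zero is a unit.\<close>

definition division_ring :: "('b, 'm) ring_scheme \<Rightarrow> bool" where
  "division_ring R \<longleftrightarrow> Ring.ring R \<and> Units R = carrier R - {\<zero>\<^bsub>R\<^esub>}"

text \<open>The set \<open>RaR\<close> of finite sums; it need not contain \<open>a\<close>, as \<open>R\<close> may lack a unit.\<close>

definition principal_sums :: "'a::ring \<Rightarrow> 'a set" where
  "principal_sums a = {(\<Sum>i<n. r i * a * s i) | (n::nat) r s. True}"

definition purely_infinite_ring :: "'a::ring itself \<Rightarrow> bool" where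
  "purely_infinite_ring _ \<longleftrightarrow>
     (\<nexists>(I::'a set) e. two_sided_ideal I \<and> division_ring (ring_record e Quot I)) \<and>
     (\<forall>a b::'a. b \<in> principal_sums a \<longrightarrow> (\<exists>x y. b = x * a * y))"


section \<open>C*-algebras\<close>

class cstar_algebra = real_normed_algebra + banach +
  fixes scaleC :: "complex \<Rightarrow> 'a \<Rightarrow> 'a" (infixr \<open>*\<^sub>C\<close> 75)
    and star :: "'a \<Rightarrow> 'a"
  assumes scaleC_of_real: "scaleC (complex_of_real r) x = r *\<^sub>R x"
    and scaleC_add_right: "scaleC c (x + y) = scaleC c x + scaleC c y"
    and scaleC_add_left: "scaleC (c + d) x = scaleC c x + scaleC d x"
    and scaleC_scaleC: "scaleC c (scaleC d x) = scaleC (c * d) x"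
    and mult_scaleC_left: "scaleC c x * y = scaleC c (x * y)"
    and mult_scaleC_right: "x * scaleC c y = scaleC c (x * y)"
    and norm_scaleC: "norm (scaleC c x) = cmod c * norm x"
    and star_add: "star (x + y) = star x + star y"
    and star_scaleC: "star (scaleC c x) = scaleC (cnj c) (star x)"
    and star_mult: "star (x * y) = star y * star x"
    and star_star: "star (star x) = x"
    and cstar_identity: "norm (star x * x) = (norm x)\<^sup>2"

text \<open>
  The product of the unitization \<open>A \<oplus> \<complex>\<close>, where \<open>(a, c)\<close> stands for \<open>a + c 1\<close>; the unit is
  \<open>(0, 1)\<close>. The spectrum of \<open>a\<close> is computed in the unitization whether or not \<open>A\<close> has a unit; if it
  does, this differs from the spectrum in \<open>A\<close> at most by the point 0, which does not affect
  positivity.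
\<close>

definition unitization_mult ::
    "'a::cstar_algebra \<times> complex \<Rightarrow> 'a \<times> complex \<Rightarrow> 'a \<times> complex" where
  "unitization_mult p q =
     (fst p * fst q + snd p *\<^sub>C fst q + snd q *\<^sub>C fst p, snd p * snd q)"

definition spectrum :: "'a::cstar_algebra \<Rightarrow> complex set" where
  "spectrum a =
     {c. \<nexists>q. unitization_mult (a, - c) q = (0, 1) \<and> unitization_mult q (a, - c) = (0, 1)}"

definition positive :: "'a::cstar_algebra \<Rightarrow> bool" where
  "positive a \<longleftrightarrow> star a = a \<and> spectrum a \<subseteq> \<real>\<^sub>\<ge>\<^sub>0"

definition cuntz_le :: "'a::cstar_algebra \<Rightarrow> 'a \<Rightarrow> bool" (infix \<open>\<precsim>\<close> 50) where
  "b \<precsim> a \<longleftrightarrow> (\<exists>x::nat \<Rightarrow> 'a. (\<lambda>i. x i * a * star (x i)) \<longlonglongrightarrow> b)"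

text \<open>
  Characters are nonzero homomorphisms of complex algebras; preservation of the involution is not
  required.
\<close>

definition character :: "('a::cstar_algebra \<Rightarrow> complex) \<Rightarrow> bool" where
  "character h \<longleftrightarrow>
     (\<forall>x y. h (x + y) = h x + h y) \<and> (\<forall>c x. h (c *\<^sub>C x) = c * h x) \<and>
     (\<forall>x y. h (x * y) = h x * h y) \<and> (\<exists>x. h x \<noteq> 0)"

definition purely_infinite_cstar :: "'a::cstar_algebra itself \<Rightarrow> bool" where
  "purely_infinite_cstar _ \<longleftrightarrow>
     (\<nexists>h :: 'a \<Rightarrow> complex. character h) \<and>
     (\<forall>a b::'a. positive a \<longrightarrow> positive b \<longrightarrow> (b \<precsim> a \<longleftrightarrow> b \<in> closure (principal_sums a)))"

end

theory Submission
  imports Defs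
begin

text \<open>
  A character is a surjective homomorphism onto \<open>\<complex>\<close>, so the quotient by its kernel is a division
  ring; hence a purely infinite ring has no characters. That \<open>b \<precsim> a\<close> puts \<open>b\<close> into the closed ideal
  generated by \<open>a\<close> is immediate.

  For the converse let \<open>b\<close> be positive and within \<open>\<eta>\<close> of \<open>AaA\<close>. Ring-theoretic pure infiniteness turns
  the approximating finite sum into a single product, \<open>b \<approx> x a y\<close>. Positive elements have selfadjoint
  square roots, \<open>a = e\<^sup>2\<close> and \<open>b = d\<^sup>2\<close>. Put \<open>u = x e\<close> and \<open>m = (u u\<^sup>* + \<epsilon>)\<^sup>-\<^sup>1\<^sup>/\<^sup>2\<close>. Then
  \<open>z = 1 - m u u\<^sup>* m = \<epsilon> m\<^sup>2\<close> is a contraction with \<open>\<parallel>z u\<parallel>\<^sup>2 \<le> 2\<epsilon>\<close>. As \<open>b\<close> is close to \<open>u (e y)\<close>, the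
  element \<open>z b\<close> is small, so \<open>z d\<close> is small by the C*-identity, and \<open>b\<close> is close to
  \<open>d (1 - z) d = (d m x) a (d m x)\<^sup>*\<close>, which is of the form required for \<open>b \<precsim> a\<close>
  (\<open>compression_approx\<close>). The factor \<open>m\<close> lives in the unitization only, but \<open>d m x\<close> is in \<open>A\<close>.

  This needs square roots of positive elements, and of \<open>u u\<^sup>* + \<epsilon>\<close>, for which \<open>u u\<^sup>*\<close> has to be positive.
  Both are obtained without Gelfand theory or spectral radii, from one analytic input: an iteration
  giving \<open>\<surd>h\<close> whenever \<open>h = h\<^sup>*\<close> and \<open>\<parallel>1 - h\<parallel> \<le> 1\<close> (\<open>cstar_sqrt\<close>). Call an element positive if it is the
  square of a selfadjoint one. For selfadjoint \<open>h\<close> and \<open>N \<ge> \<parallel>h\<parallel>\<close> this is equivalent to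
  \<open>\<parallel>N - h\<parallel> \<le> N\<close>, a condition that behaves well under sums and limits. From it follow that the positive
  elements form a cone meeting its negative in 0 only, that \<open>a\<close> is positive once \<open>a + t\<close> is invertible
  for every \<open>t > 0\<close> (\<open>sa_square_of_resolvents\<close>, the bridge to the spectrum), and Kaplansky's theorem
  that \<open>x x\<^sup>*\<close> is positive (\<open>sa_square_mult_star\<close>).
\<close>


section \<open>The involution\<close>

lemma scaleC_one [simp]: "1 *\<^sub>C (x::'a::cstar_algebra) = x"
  using scaleC_of_real[of 1 x] by simp

lemma scaleC_zero_left [simp]: "0 *\<^sub>C (x::'a::cstar_algebra) = 0"
  using scaleC_of_real[of 0 x] by simp

lemma scaleC_zero_right [simp]: "c *\<^sub>C (0::'a::cstar_algebra) = 0"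
  using scaleC_add_right[of c "0::'a" 0] by simp

lemma scaleC_minus_left: "(- c) *\<^sub>C (x::'a::cstar_algebra) = - (c *\<^sub>C x)"
  using scaleC_add_left[of c "-c" x] by (simp add: minus_equation_iff[of "c *\<^sub>C x"] add_eq_0_iff2)

lemma scaleC_minus_right: "c *\<^sub>C (- x::'a::cstar_algebra) = - (c *\<^sub>C x)"
  using scaleC_add_right[of c x "-x"] by (simp add: add_eq_0_iff)

lemma scaleC_diff_right: "c *\<^sub>C (x - y::'a::cstar_algebra) = c *\<^sub>C x - c *\<^sub>C y"
  using scaleC_add_right[of c x "-y"] by (simp add: scaleC_minus_right)

lemma star_scaleR: "star (r *\<^sub>R (x::'a::cstar_algebra)) = r *\<^sub>R star x"
  using star_scaleC[of "complex_of_real r" x] by (simp add: scaleC_of_real)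

lemma star_zero [simp]: "star (0::'a::cstar_algebra) = 0"
  using star_scaleR[of 0 "0::'a"] by simp

lemma star_minus: "star (- x::'a::cstar_algebra) = - star x"
  using star_scaleR[of "-1" x] by simp

lemma star_diff: "star (x - y::'a::cstar_algebra) = star x - star y"
  using star_add[of x "-y"] by (simp add: star_minus)

lemma norm_star [simp]: "norm (star (x::'a::cstar_algebra)) = norm x"
proof -
  have *: "norm y \<le> norm (star y)" for y :: 'a
  proof (cases "y = 0")
    case False
    have "norm y * norm y \<le> norm (star y) * norm y"
      using cstar_identity[of y] norm_mult_ineq[of "star y" y] by (simp add: power2_eq_square)
    with False show ?thesis by simp
  qed simp
  from *[of x] *[of "star x"] show ?thesis by (simp add: star_star)
qed

lemma cstar_identity': "norm (x * star (x::'a::cstar_algebra)) = (norm x)\<^sup>2"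
  using cstar_identity[of "star x"] by (simp add: star_star)

lemma norm_square_selfadjoint:
  "star h = h \<Longrightarrow> norm (h * h) = (norm (h::'a::cstar_algebra))\<^sup>2"
  using cstar_identity[of h] by simp

lemma bounded_linear_star: "bounded_linear (star :: 'a::cstar_algebra \<Rightarrow> 'a)"
  by (rule bounded_linear_intro[of _ 1]) (simp_all add: star_add star_scaleR)

text \<open>
  The norm of the unit is 1, which excludes the zero algebra; the unitization of the zero algebra is
  \<open>\<complex>\<close>, so this costs nothing below.
\<close>

class unital_cstar_algebra = cstar_algebra + real_normed_algebra_1

lemma star_one [simp]: "star (1::'a::unital_cstar_algebra) = 1"
  using star_mult[of "star (1::'a)" 1] by (simp add: star_star)

lemma star_of_real [simp]: "star (of_real r :: 'a::unital_cstar_algebra) = of_real r"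
  by (simp add: of_real_def star_scaleR)

lemma of_real_commute: "of_real r * (z::'a::real_algebra_1) = z * of_real r"
  by (simp add: of_real_def)


section \<open>Square roots\<close>

text \<open>
  The fixed-point iteration for \<open>2y = k + y\<^sup>2\<close>, that is, for \<open>(1 - y)\<^sup>2 = 1 - k\<close>. Its terms are polynomials
  in \<open>k\<close> with nonnegative coefficients, so for \<open>\<parallel>k\<parallel> \<le> 1\<close> they and their increments are dominated by the
  scalar iteration at \<open>k = 1\<close>. That one is increasing and bounded, which gives convergence even in the
  boundary case \<open>\<parallel>k\<parallel> = 1\<close>.
\<close>

primrec sqrt_iter :: "'a::real_normed_algebra \<Rightarrow> nat \<Rightarrow> 'a" where
  "sqrt_iter k 0 = 0"
| "sqrt_iter k (Suc n) = (1/2) *\<^sub>R (k + sqrt_iter k n * sqrt_iter k n)"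

lemma sqrt_iter_commute: "z * k = k * z \<Longrightarrow> z * sqrt_iter k n = sqrt_iter k n * z"
proof (induction n)
  case (Suc n)
  hence "z * sqrt_iter k n = sqrt_iter k n * z" by simp
  hence "z * (sqrt_iter k n * sqrt_iter k n) = (sqrt_iter k n * sqrt_iter k n) * z"
    by (metis mult.assoc)
  with Suc.prems show ?case by (simp add: algebra_simps)
qed simp

lemma sqrt_iter_real: "0 \<le> sqrt_iter (1::real) n \<and> sqrt_iter (1::real) n \<le> 1"
proof (induction n)
  case (Suc n)
  hence "sqrt_iter (1::real) n * sqrt_iter 1 n \<le> 1" by (simp add: mult_le_one)
  with Suc show ?case by simp
qed simp

lemma norm_sqrt_iter:
  assumes "norm k \<le> 1"
  shows "norm (sqrt_iter k n) \<le> sqrt_iter (1::real) n"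
proof (induction n)
  case (Suc n)
  have "norm (k + sqrt_iter k n * sqrt_iter k n) \<le> 1 + sqrt_iter 1 n * sqrt_iter (1::real) n"
    using Suc assms
    by (intro norm_triangle_mono order_trans[OF norm_mult_ineq] mult_mono)
       (auto simp: sqrt_iter_real)
  thus ?case by simp
qed simp

text \<open>
  Consecutive terms commute, so that \<open>y\<^sub>n\<^sub>+\<^sub>2 - y\<^sub>n\<^sub>+\<^sub>1 = (y\<^sub>n\<^sub>+\<^sub>1 - y\<^sub>n)(y\<^sub>n\<^sub>+\<^sub>1 + y\<^sub>n)/2\<close>; the scalar iteration
  satisfies the same recurrence.
\<close>

lemma norm_sqrt_iter_diff:
  assumes "norm k \<le> 1"
  shows "norm (sqrt_iter k (Suc n) - sqrt_iter k n)
           \<le> sqrt_iter (1::real) (Suc n) - sqrt_iter 1 n"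
proof (induction n)
  case (Suc n)
  let ?y = "sqrt_iter k" and ?t = "sqrt_iter (1::real)"
  have c: "?y (Suc n) * ?y n = ?y n * ?y (Suc n)"
    by (intro sqrt_iter_commute sym[OF sqrt_iter_commute]) simp
  have "?y (Suc (Suc n)) - ?y (Suc n) = (1/2) *\<^sub>R (?y (Suc n) * ?y (Suc n) - ?y n * ?y n)"
    by (simp add: algebra_simps)
  also have "?y (Suc n) * ?y (Suc n) - ?y n * ?y n
      = (?y (Suc n) - ?y n) * (?y (Suc n) + ?y n)"
    using c by (simp add: algebra_simps del: sqrt_iter.simps)
  finally have "norm (?y (Suc (Suc n)) - ?y (Suc n))
      = (1/2) * norm ((?y (Suc n) - ?y n) * (?y (Suc n) + ?y n))"
    by (simp del: sqrt_iter.simps)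
  also have "\<dots> \<le> (1/2) * ((?t (Suc n) - ?t n) * (?t (Suc n) + ?t n))"
    using Suc.IH
    by (intro mult_left_mono order_trans[OF norm_mult_ineq] mult_mono norm_triangle_mono
          norm_sqrt_iter assms order_trans[OF norm_ge_zero Suc.IH])
       (auto simp del: sqrt_iter.simps)
  also have "\<dots> = ?t (Suc (Suc n)) - ?t (Suc n)"
    by (simp add: field_simps)
  finally show ?case .
qed (use assms in simp)

lemma convergent_sqrt_iter:
  fixes k :: "'a::{real_normed_algebra,banach}"
  assumes "norm k \<le> 1"
  shows "convergent (sqrt_iter k)"
proof -
  let ?t = "sqrt_iter (1::real)"
  have inc: "incseq ?t"
    by (rule incseq_SucI)
       (use norm_sqrt_iter_diff[of "1::real"] order_trans[OF norm_ge_zero] in force)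
  have "convergent ?t"
    by (rule Bseq_monoseq_convergent)
       (use inc sqrt_iter_real in \<open>auto simp: monoseq_iff intro!: BseqI'[of _ 1]\<close>)
  then obtain l where "?t \<longlonglongrightarrow> l" by (auto simp: convergent_def)
  hence "summable (\<lambda>n. ?t (Suc n) - ?t n)" by (rule telescope_summable)
  hence "summable (\<lambda>n. sqrt_iter k (Suc n) - sqrt_iter k n)"
    by (rule summable_comparison_test'[of _ 0]) (use norm_sqrt_iter_diff[OF assms] in auto)
  hence "convergent (\<lambda>n. \<Sum>i<n. sqrt_iter k (Suc i) - sqrt_iter k i)"
    by (simp only: summable_iff_convergent)
  moreover have "(\<Sum>i<n. sqrt_iter k (Suc i) - sqrt_iter k i) = sqrt_iter k n" for n
    by (subst sum_lessThan_telescope) simp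
  ultimately show ?thesis by simp
qed

text \<open>
  The root is \<open>1 - y\<close> for the limit \<open>y\<close> of the iteration at \<open>1 - h\<close>. Being a limit of polynomials in \<open>h\<close>, it
  commutes with whatever commutes with \<open>h\<close>; this is what makes products of commuting positive elements
  positive.
\<close>

lemma cstar_sqrt:
  fixes h :: "'a::unital_cstar_algebra"
  assumes sa: "star h = h" and le: "norm (1 - h) \<le> 1"
  obtains s where "star s = s" "s * s = h" "norm (1 - s) \<le> 1"
    "\<And>z. z * h = h * z \<Longrightarrow> z * s = s * z"
proof -
  define k where "k = 1 - h"
  let ?y = "sqrt_iter k"
  obtain y where y: "?y \<longlonglongrightarrow> y"
    using convergent_sqrt_iter[of k] le by (auto simp: k_def convergent_def)
  have sk: "star k = k" using sa by (simp add: k_def star_diff)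
  have "star (?y n) = ?y n" for n
    by (induction n) (simp_all add: star_scaleR star_add star_mult sk)
  hence "?y \<longlonglongrightarrow> star y"
    using bounded_linear.tendsto[OF bounded_linear_star y] by simp
  hence sy: "star y = y" using y LIMSEQ_unique by blast
  have "(\<lambda>n. ?y (Suc n)) \<longlonglongrightarrow> (1/2) *\<^sub>R (k + y * y)"
    unfolding sqrt_iter.simps by (intro tendsto_intros y)
  moreover have "(\<lambda>n. ?y (Suc n)) \<longlonglongrightarrow> y" using y by (rule LIMSEQ_Suc)
  ultimately have "y = (1/2) *\<^sub>R (k + y * y)" using LIMSEQ_unique by blast
  hence "2 *\<^sub>R y = k + y * y" by (metis scaleR_half_double scaleR_2 scaleR_right_distrib)
  hence yy: "y + y = k + y * y" by (simp add: scaleR_2)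
  have ny: "norm y \<le> 1"
  proof (rule LIMSEQ_le_const2[OF tendsto_norm[OF y]])
    have "norm (?y n) \<le> 1" for n
      using norm_sqrt_iter[of k n] le sqrt_iter_real[of n] unfolding k_def by linarith
    thus "\<exists>N. \<forall>n\<ge>N. norm (?y n) \<le> 1" by blast
  qed
  have comm: "z * y = y * z" if "z * h = h * z" for z
  proof -
    have "z * ?y n = ?y n * z" for n
      by (rule sqrt_iter_commute) (use that in \<open>simp add: k_def algebra_simps\<close>)
    moreover have "(\<lambda>n. z * ?y n) \<longlonglongrightarrow> z * y" "(\<lambda>n. ?y n * z) \<longlonglongrightarrow> y * z"
      by (intro tendsto_intros y)+
    ultimately show ?thesis using LIMSEQ_unique by fastforce
  qed
  show ?thesis
  proof
    show "star (1 - y) = 1 - y" by (simp add: star_diff sy)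
    have "(1 - y) * (1 - y) = 1 - (y + y) + y * y" by (simp add: algebra_simps)
    thus "(1 - y) * (1 - y) = h" unfolding yy by (simp add: k_def)
    show "norm (1 - (1 - y)) \<le> 1" using ny by simp
    show "z * (1 - y) = (1 - y) * z" if "z * h = h * z" for z
      using comm[OF that] by (simp add: algebra_simps)
  qed
qed


section \<open>The positive cone of a unital C*-algebra\<close>

text \<open>
  The squares of selfadjoint elements are exactly the positive elements. This description serves as
  the working notion of positivity because it requires no spectral theory.
\<close>

definition sa_square :: "'a::cstar_algebra \<Rightarrow> bool" where
  "sa_square h \<longleftrightarrow> (\<exists>s. star s = s \<and> h = s * s)"

lemma sa_square_selfadjoint: "sa_square h \<Longrightarrow> star h = h"
  by (auto simp: sa_square_def star_mult)

text \<open>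
  With \<open>s = \<surd>(1 - h\<^sup>2)\<close>, the element \<open>u = h + \<i>s\<close> is unitary, so its imaginary part \<open>s\<close> is a contraction.
\<close>

lemma norm_one_minus_square:
  fixes h :: "'a::unital_cstar_algebra"
  assumes h: "star h = h" and le: "norm h \<le> 1"
  shows "norm (1 - h * h) \<le> 1"
proof -
  have n1: "norm (1 - (1 - h * h)) \<le> 1"
    using le by (simp add: norm_square_selfadjoint h power_le_one)
  have s1: "star (1 - h * h) = 1 - h * h" by (simp add: star_diff star_mult h)
  obtain s where s: "star s = s" "s * s = 1 - h * h"
    and comm: "\<And>z. z * (1 - h * h) = (1 - h * h) * z \<Longrightarrow> z * s = s * z"
    using cstar_sqrt[OF s1 n1] by blast
  have hs: "h * s = s * h" by (rule comm) (simp add: algebra_simps)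
  define u where "u = h + \<i> *\<^sub>C s"
  have su: "star u = h - \<i> *\<^sub>C s"
    by (simp add: u_def star_add star_scaleC h s scaleC_minus_left)
  have "star u * u = h * h + s * s"
    unfolding su unfolding u_def
    by (simp add: algebra_simps mult_scaleC_left mult_scaleC_right scaleC_scaleC hs
        scaleC_minus_left scaleC_diff_right)
  hence "norm (star u * u) = 1" by (simp add: s)
  hence "(norm u)\<^sup>2 = 1" by (simp add: cstar_identity)
  hence nu: "norm u = 1" using power2_eq_1_iff[of "norm u"] norm_ge_zero[of u] by linarith
  have "u - star u = (2 * \<i>) *\<^sub>C s"
    unfolding su unfolding u_def by (simp add: scaleC_add_left[symmetric])
  hence "2 * norm s = norm (u - star u)" by (simp add: norm_scaleC norm_mult)
  also have "\<dots> \<le> 2" using norm_triangle_ineq4[of u "star u"] nu by simp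
  finally have "norm s \<le> 1" by simp
  moreover have "norm (1 - h * h) = (norm s)\<^sup>2" by (metis s norm_square_selfadjoint)
  ultimately show ?thesis by (simp add: power_le_one)
qed

text \<open>
  The rescaled form of the square root lemma. The root satisfies the same kind of norm estimate,
  hence has itself a root.
\<close>

lemma sa_squareE:
  fixes h :: "'a::unital_cstar_algebra"
  assumes "star h = h" "norm (of_real N - h) \<le> N"
  obtains s where "star s = s" "s * s = h" "norm (of_real (sqrt N) - s) \<le> sqrt N"
    "\<And>z. z * h = h * z \<Longrightarrow> z * s = s * z"
proof (cases "N = 0")
  case True
  with assms(2) that[of 0] show ?thesis by simp
next
  case False
  with assms(2) have N: "N > 0" using norm_ge_zero[of "of_real N - h"] by linarith
  define k where "k = inverse N *\<^sub>R h"
  have "1 - k = inverse N *\<^sub>R (of_real N - h)"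
    using N by (simp add: k_def algebra_simps of_real_def)
  hence "norm (1 - k) = inverse N * norm (of_real N - h)" using N by (simp del: inverse_eq_divide)
  also have "\<dots> \<le> inverse N * N" using N assms(2) by (intro mult_left_mono) auto
  finally have k1: "norm (1 - k) \<le> 1" using N by simp
  have sk: "star k = k" by (simp add: k_def star_scaleR assms)
  obtain s where s: "star s = s" "s * s = k" "norm (1 - s) \<le> 1"
    and comm: "\<And>z. z * k = k * z \<Longrightarrow> z * s = s * z"
    using cstar_sqrt[OF sk k1] by blast
  show ?thesis
  proof
    show "star (sqrt N *\<^sub>R s) = sqrt N *\<^sub>R s" by (simp add: star_scaleR s)
    have "(sqrt N *\<^sub>R s) * (sqrt N *\<^sub>R s) = (sqrt N * sqrt N) *\<^sub>R (s * s)" by simp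
    also have "\<dots> = h" using N by (simp add: s k_def)
    finally show "(sqrt N *\<^sub>R s) * (sqrt N *\<^sub>R s) = h" .
    have "of_real (sqrt N) - sqrt N *\<^sub>R s = sqrt N *\<^sub>R (1 - s)"
      by (simp add: algebra_simps of_real_def)
    thus "norm (of_real (sqrt N) - sqrt N *\<^sub>R s) \<le> sqrt N"
      using N s(3) by (simp add: mult_left_le)
    show "z * (sqrt N *\<^sub>R s) = (sqrt N *\<^sub>R s) * z" if "z * h = h * z" for z
      using comm[of z] that by (simp add: k_def)
  qed
qed

lemma sa_squareI:
  fixes h :: "'a::unital_cstar_algebra"
  assumes "star h = h" "norm (of_real N - h) \<le> N"
  shows "sa_square h"
  using sa_squareE[OF assms] by (metis sa_square_def)

text \<open>
  Together with \<open>sa_squareI\<close> this describes the positive cone by norms alone.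
\<close>

lemma sa_square_norm_le:
  fixes h :: "'a::unital_cstar_algebra"
  assumes "sa_square h" "norm h \<le> N"
  shows "norm (of_real N - h) \<le> N"
proof -
  from assms obtain s where s: "star s = s" "h = s * s" by (auto simp: sa_square_def)
  have N0: "N \<ge> 0" using assms(2) norm_ge_zero order_trans by blast
  show ?thesis
  proof (cases "N = 0")
    case True
    with assms show ?thesis by simp
  next
    case False
    with N0 have N: "N > 0" by simp
    define r where "r = inverse (sqrt N) *\<^sub>R s"
    have "(norm s)\<^sup>2 \<le> N" using assms(2) s by (simp add: norm_square_selfadjoint)
    hence "norm s \<le> sqrt N" using real_le_rsqrt by blast
    hence "norm r \<le> 1" using N by (simp add: r_def field_simps)
    hence "norm (1 - r * r) \<le> 1" by (intro norm_one_minus_square) (simp_all add: r_def star_scaleR s)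
    moreover have "of_real N - h = N *\<^sub>R (1 - r * r)"
    proof -
      have "r * r = inverse (sqrt N * sqrt N) *\<^sub>R h"
        by (simp add: r_def s del: real_sqrt_mult_self)
      thus ?thesis using N by (simp add: algebra_simps of_real_def)
    qed
    ultimately show ?thesis using N by (simp add: mult_left_le)
  qed
qed

lemma sa_square_root:
  fixes h :: "'a::unital_cstar_algebra"
  assumes "sa_square h"
  obtains s where "sa_square s" "s * s = h" "\<And>z. z * h = h * z \<Longrightarrow> z * s = s * z"
  using sa_squareE[OF sa_square_selfadjoint[OF assms] sa_square_norm_le[OF assms order_refl]]
  by (metis sa_squareI)

lemma sa_square_square: "star s = s \<Longrightarrow> sa_square (s * s)"
  by (auto simp: sa_square_def)

lemma sa_square_add:
  fixes h k :: "'a::unital_cstar_algebra"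
  assumes "sa_square h" "sa_square k"
  shows "sa_square (h + k)"
proof (rule sa_squareI)
  show "star (h + k) = h + k" using assms by (simp add: star_add sa_square_selfadjoint)
  have "norm ((of_real (norm h) - h) + (of_real (norm k) - k)) \<le> norm h + norm k"
    by (intro norm_triangle_mono sa_square_norm_le assms order_refl)
  thus "norm (of_real (norm h + norm k) - (h + k)) \<le> norm h + norm k"
    by (simp add: algebra_simps)
qed

lemma sa_square_mult:
  fixes h k :: "'a::unital_cstar_algebra"
  assumes "sa_square h" "sa_square k" "h * k = k * h"
  shows "sa_square (h * k)"
proof -
  obtain s where s: "sa_square s" "s * s = h" "\<And>z. z * h = h * z \<Longrightarrow> z * s = s * z"
    using sa_square_root[OF assms(1)] by blast
  obtain r where r: "sa_square r" "r * r = k" "\<And>z. z * k = k * z \<Longrightarrow> z * r = r * z"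
    using sa_square_root[OF assms(2)] by blast
  have "k * s = s * k" using s(3) assms(3) by simp
  hence sr: "s * r = r * s" using r(3) by simp
  have "h * k = (s * r) * (s * r)" using s(2) r(2) sr by (metis mult.assoc)
  moreover have "star (s * r) = s * r"
    using s(1) r(1) sr by (simp add: star_mult sa_square_selfadjoint)
  ultimately show ?thesis by (auto simp: sa_square_def)
qed

text \<open>
  Commuting selfadjoint roots \<open>s\<close> of \<open>h\<close> and \<open>r\<close> of \<open>-h\<close> make \<open>x = s + \<i>r\<close> satisfy \<open>x\<^sup>* x = s\<^sup>2 + r\<^sup>2 = 0\<close>.
\<close>

lemma sa_square_antisym:
  fixes h :: "'a::unital_cstar_algebra"
  assumes "sa_square h" "sa_square (- h)"
  shows "h = 0"
proof -
  obtain s where s: "sa_square s" "s * s = h" "\<And>z. z * h = h * z \<Longrightarrow> z * s = s * z"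
    using sa_square_root[OF assms(1)] by blast
  obtain r where r: "sa_square r" "r * r = - h" "\<And>z. z * - h = - h * z \<Longrightarrow> z * r = r * z"
    using sa_square_root[OF assms(2)] by blast
  have "h * s = s * h" using s(2) by (metis mult.assoc)
  hence "s * - h = - h * s" by simp
  hence sr: "s * r = r * s" using r(3) by simp
  define x where "x = s + \<i> *\<^sub>C r"
  have sx: "star x = s - \<i> *\<^sub>C r"
    using s(1) r(1)
    by (simp add: x_def star_add star_scaleC sa_square_selfadjoint scaleC_minus_left)
  have "star x * x = s * s + r * r"
    unfolding sx unfolding x_def
    by (simp add: algebra_simps mult_scaleC_left mult_scaleC_right scaleC_scaleC sr
        scaleC_minus_left scaleC_diff_right)
  hence "x = 0" using cstar_identity[of x] by (simp add: s r)
  hence "x + star x = 0" by simp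
  hence "s + s = 0" unfolding sx unfolding x_def by simp
  hence "s = 0" by (metis scaleR_2 scaleR_eq_0_iff zero_neq_numeral)
  thus ?thesis using s(2) by simp
qed

definition two_sided_inverse :: "'a::monoid_mult \<Rightarrow> 'a \<Rightarrow> bool" where
  "two_sided_inverse x g \<longleftrightarrow> g * x = 1 \<and> x * g = 1"

lemma neumann_inverse:
  fixes k :: "'a::{real_normed_algebra_1,banach}"
  assumes "norm k < 1"
  shows "\<exists>g. two_sided_inverse (1 - k) g"
proof -
  have sm: "summable (\<lambda>n. k ^ n)" by (rule complete_algebra_summable_geometric[OF assms])
  define g where "g = (\<Sum>n. k ^ n)"
  have "g = (\<Sum>n. k ^ Suc n) + 1" unfolding g_def using suminf_split_head[OF sm] by simp
  moreover have "(\<Sum>n. k ^ Suc n) = k * g" "(\<Sum>n. k ^ Suc n) = g * k"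
    unfolding g_def using suminf_mult[OF sm, of k] suminf_mult2[OF sm, of k]
    by (simp_all add: power_commutes)
  ultimately have "g = k * g + 1" "g = g * k + 1" by simp_all
  hence "two_sided_inverse (1 - k) g" by (simp add: two_sided_inverse_def algebra_simps)
  thus ?thesis by blast
qed

text \<open>
  \<open>q + \<epsilon> = (M + \<epsilon>) - (M - q)\<close> with \<open>\<parallel>M - q\<parallel> \<le> M = \<parallel>q\<parallel>\<close>, so the Neumann series gives the inverse together
  with its bound.
\<close>

lemma sa_square_resolvent:
  fixes q :: "'a::unital_cstar_algebra"
  assumes q: "sa_square q" and \<epsilon>: "\<epsilon> > 0"
  obtains g where "two_sided_inverse (q + of_real \<epsilon>) g" "\<epsilon> * norm g \<le> 1"
proof -
  define M where "M = norm q"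
  have M: "norm (of_real M - q) \<le> M" "M \<ge> 0"
    using sa_square_norm_le[OF q order_refl] by (simp_all add: M_def)
  define k where "k = inverse (M + \<epsilon>) *\<^sub>R (of_real M - q)"
  have "norm k = norm (of_real M - q) / (M + \<epsilon>)" using M \<epsilon> by (simp add: k_def divide_inverse_commute)
  hence "norm k < 1" using M \<epsilon> by simp
  then obtain g0 where g0: "two_sided_inverse (1 - k) g0" using neumann_inverse by blast
  define g where "g = inverse (M + \<epsilon>) *\<^sub>R g0"
  have eq: "q + of_real \<epsilon> = (M + \<epsilon>) *\<^sub>R (1 - k)"
    using M \<epsilon> by (simp add: k_def scaleR_diff_right of_real_def scaleR_add_left)
  have inv: "two_sided_inverse (q + of_real \<epsilon>) g"
    unfolding eq using g0 M \<epsilon> by (simp add: two_sided_inverse_def g_def)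
  have "(M + \<epsilon>) *\<^sub>R g = g * (q + of_real \<epsilon>) + g * (of_real M - q)"
    by (simp add: algebra_simps of_real_def)
  hence "(M + \<epsilon>) *\<^sub>R g = 1 + g * (of_real M - q)" using inv by (simp add: two_sided_inverse_def)
  hence "(M + \<epsilon>) * norm g = norm (1 + g * (of_real M - q))"
    using M \<epsilon> by (metis abs_of_nonneg add_nonneg_nonneg less_imp_le norm_scaleR)
  also have "\<dots> \<le> 1 + norm g * M"
    using M by (intro norm_triangle_mono order_trans[OF norm_mult_ineq] mult_left_mono) simp_all
  finally have "\<epsilon> * norm g \<le> 1" by (simp add: algebra_simps)
  with inv that show ?thesis by blast
qed

lemma two_sided_inverse_selfadjoint:
  fixes x :: "'a::unital_cstar_algebra"
  assumes "two_sided_inverse x g" "star x = x"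
  shows "star g = g"
proof -
  have "star g * x = 1"
    using assms star_mult[of x g] by (simp add: two_sided_inverse_def)
  hence "star g * (x * g) = g" by (simp add: mult.assoc[symmetric])
  thus ?thesis using assms(1) by (simp add: two_sided_inverse_def)
qed

text \<open>
  By the norm description of the cone, for \<open>t \<ge> 0\<close> the element \<open>a + t\<close> is positive iff \<open>t \<ge> T\<close>, where \<open>T\<close>
  is read off from \<open>a\<close>. If \<open>T > 0\<close>, then \<open>a + T\<close> is positive and invertible, and such an element stays
  positive when a small multiple of 1 is subtracted, against the choice of \<open>T\<close>.
\<close>

lemma sa_square_of_resolvents:
  fixes a :: "'a::unital_cstar_algebra"
  assumes sa: "star a = a" and inv: "\<And>t. t > 0 \<Longrightarrow> \<exists>g. two_sided_inverse (a + of_real t) g"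
  shows "sa_square a"
proof -
  define T where "T = norm (of_real (norm a) - a) - norm a"
  have iff: "sa_square (a + of_real t) \<longleftrightarrow> T \<le> t" if "t \<ge> 0" for t
  proof -
    have eq: "of_real (norm a + t) - (a + of_real t) = of_real (norm a) - a" by simp
    have "norm (a + of_real t) \<le> norm a + t"
      using norm_triangle_ineq[of a "of_real t"] that by simp
    from sa_square_norm_le[OF _ this] sa_squareI[of "a + of_real t" "norm a + t"]
    show ?thesis unfolding eq by (auto simp: T_def star_add sa)
  qed
  have "T \<le> 0"
  proof (rule ccontr)
    assume "\<not> T \<le> 0"
    hence T: "T > 0" by simp
    obtain g where g: "two_sided_inverse (a + of_real T) g" using inv[OF T] by blast
    \<comment> \<open>Small enough that \<open>1 - \<delta>g\<close> is positive and \<open>T - \<delta> \<ge> 0\<close>.\<close>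
    define \<delta> where "\<delta> = min T (inverse (norm g + 1))"
    have \<delta>: "\<delta> > 0" "\<delta> \<le> T" "\<delta> \<le> inverse (norm g + 1)"
      using T by (auto simp: \<delta>_def add_nonneg_pos)
    have "\<delta> * norm g \<le> inverse (norm g + 1) * norm g" using \<delta> by (intro mult_right_mono) auto
    also have "\<dots> \<le> 1" by (simp add: divide_inverse_commute[symmetric] add_nonneg_pos)
    finally have "\<delta> * norm g \<le> 1" .
    moreover have "star g = g"
      using two_sided_inverse_selfadjoint[OF g] by (simp add: star_add sa)
    ultimately have "sa_square (1 - \<delta> *\<^sub>R g)"
      using \<delta> by (intro sa_squareI[where N=1]) (simp_all add: star_diff star_scaleR)
    moreover have "sa_square (a + of_real T)" using iff T by simp
    moreover have "(a + of_real T) * (1 - \<delta> *\<^sub>R g) = a + of_real (T - \<delta>)"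
      "(1 - \<delta> *\<^sub>R g) * (a + of_real T) = a + of_real (T - \<delta>)"
      using g by (simp_all only: two_sided_inverse_def right_diff_distrib left_diff_distrib
          mult_scaleR_left mult_scaleR_right mult_1_left mult_1_right)
        (simp_all add: of_real_def algebra_simps)
    ultimately have "sa_square (a + of_real (T - \<delta>))"
      using sa_square_mult[of "a + of_real T" "1 - \<delta> *\<^sub>R g"] by simp
    thus False using iff[of "T - \<delta>"] \<delta> by simp
  qed
  thus ?thesis using iff[of 0] by simp
qed

text \<open>
  The familiar fact that \<open>v w\<close> and \<open>w v\<close> have the same nonzero spectrum: the inverse of \<open>w v + t\<close> is
  \<open>(1 - w g v) / t\<close>.
\<close>

lemma two_sided_inverse_swap:
  fixes v w :: "'a::real_algebra_1"
  assumes t: "t \<noteq> 0" and g: "two_sided_inverse (v * w + of_real t) g"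
  shows "\<exists>g'. two_sided_inverse (w * v + of_real t) g'"
proof -
  have g1: "g * (v * w) = 1 - t *\<^sub>R g" and g2: "v * w * g = 1 - t *\<^sub>R g"
    using g by (simp_all add: two_sided_inverse_def algebra_simps of_real_def)
  define f where "f = 1 - w * g * v"
  have "w * v * (w * g * v) = w * (v * w * g) * v" by (simp add: mult.assoc)
  hence "(w * v + of_real t) * f = of_real t"
    unfolding f_def g2 by (simp add: algebra_simps of_real_def g2)
  moreover have "w * g * v * (w * v) = w * (g * (v * w)) * v" by (simp add: mult.assoc)
  hence "f * (w * v + of_real t) = of_real t"
    unfolding f_def g1 by (simp add: algebra_simps of_real_def)
  ultimately have "two_sided_inverse (w * v + of_real t) (inverse t *\<^sub>R f)"
    using t by (simp add: two_sided_inverse_def of_real_def)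
  thus ?thesis by blast
qed

lemma selfadjoint_cube_eq_zero:
  fixes n :: "'a::cstar_algebra"
  assumes "star n = n" "n * n * n = 0"
  shows "n = 0"
proof -
  have "star (n * n) * (n * n) = 0"
    using assms by (simp add: star_mult mult.assoc)
  hence "n * n = 0" using cstar_identity[of "n * n"] by simp
  thus ?thesis using cstar_identity[of n] assms by simp
qed

text \<open>
  If \<open>v = h + \<i>k\<close> with selfadjoint \<open>h\<close> and \<open>k\<close>, then \<open>v v\<^sup>* = 2h\<^sup>2 + 2k\<^sup>2 - v\<^sup>* v\<close> is positive. Exchanging the
  factors leaves the nonzero spectrum unchanged, so \<open>v\<^sup>* v\<close> is positive as well as negative.
\<close>

lemma star_mult_eq_zero_if_nonpos:
  fixes v :: "'a::unital_cstar_algebra"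
  assumes "sa_square (- (star v * v))"
  shows "star v * v = 0"
proof -
  define h where "h = (1/2) *\<^sub>R (v + star v)"
  define k where "k = (\<i> / 2) *\<^sub>C (star v - v)"
  have hk: "star h = h" "star k = k"
    by (simp_all add: h_def k_def star_scaleR star_add star_scaleC star_diff star_star
        add.commute scaleC_minus_left scaleC_minus_right[symmetric])
  have kk: "k * k = (-(1/4)) *\<^sub>R ((star v - v) * (star v - v))"
    unfolding k_def
    by (simp add: mult_scaleC_left mult_scaleC_right scaleC_scaleC scaleC_of_real[symmetric])
  have "h * h + h * h + (k * k + k * k) = v * star v + star v * v"
    unfolding kk unfolding h_def by (simp add: algebra_simps scaleR_add_left[symmetric])
  hence "v * star v = h * h + h * h + (k * k + k * k) + - (star v * v)"
    by simp
  moreover have "sa_square (h * h + h * h + (k * k + k * k) + - (star v * v))"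
    by (intro sa_square_add sa_square_square hk assms)
  ultimately have vv: "sa_square (v * star v)" by simp
  have "sa_square (star v * v)"
  proof (rule sa_square_of_resolvents)
    fix t :: real assume t: "t > 0"
    show "\<exists>g. two_sided_inverse (star v * v + of_real t) g"
      using sa_square_resolvent[OF vv t] two_sided_inverse_swap t
      by (metis less_irrefl)
  qed (simp add: star_mult star_star)
  thus ?thesis using assms sa_square_antisym by blast
qed

text \<open>
  Kaplansky's argument. Let \<open>c = x x\<^sup>*\<close>, \<open>w = |c|\<close>, and let \<open>n = w - c\<close> be twice the negative part of \<open>c\<close>.
  Then \<open>v = x\<^sup>* n\<close> has \<open>v\<^sup>* v = n c n = - n\<^sup>2 w \<le> 0\<close>, so \<open>n\<^sup>2 w = 0\<close>; as \<open>n\<^sup>3 = 2 n\<^sup>2 w\<close>, the negative part vanishes.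
\<close>

lemma sa_square_mult_star:
  fixes x :: "'a::unital_cstar_algebra"
  shows "sa_square (x * star x)"
proof -
  define c where "c = x * star x"
  have sc: "star c = c" by (simp add: c_def star_mult star_star)
  obtain w where w: "sa_square w" "w * w = c * c" "\<And>z. z * (c * c) = (c * c) * z \<Longrightarrow> z * w = w * z"
    using sa_square_root[OF sa_square_square[OF sc]] by blast
  have cw: "c * w = w * c" using w(3)[of c] by (simp add: mult.assoc)
  define n where "n = w - c"
  have sn: "star n = n" using w(1) by (simp add: n_def star_diff sc sa_square_selfadjoint)
  have nw: "n * w = w * n" by (simp add: n_def algebra_simps cw)
  have nc: "n * c = - (n * w)" by (simp add: n_def algebra_simps cw w(2))
  have "n * n = n * w - n * c" by (simp add: n_def algebra_simps)
  hence nn: "n * n = n * w + n * w" using nc by simp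
  define v where "v = star x * n"
  have "star v * v = n * c * n" by (simp add: v_def c_def star_mult star_star sn mult.assoc)
  also have "\<dots> = - (n * n * w)" by (simp add: nc mult.assoc nw[symmetric])
  finally have vv: "star v * v = - (n * n * w)" .
  have "sa_square (n * n * w)"
  proof (rule sa_square_mult[OF sa_square_square[OF sn] w(1)])
    show "n * n * w = w * (n * n)" by (simp add: mult.assoc nw) (simp add: mult.assoc[symmetric] nw)
  qed
  hence "n * n * w = 0" using star_mult_eq_zero_if_nonpos[of v] vv by simp
  moreover have "n * n * n = n * n * w + n * n * w"
  proof -
    have "n * n * n = n * (n * w + n * w)" by (simp add: mult.assoc flip: nn)
    thus ?thesis by (simp add: algebra_simps)
  qed
  ultimately have "n = 0" using selfadjoint_cube_eq_zero[OF sn] by simp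
  thus ?thesis using w(1) by (simp add: n_def c_def)
qed


section \<open>Approximating a positive element\<close>

text \<open>
  The witness is \<open>m = (q + \<epsilon>)\<^sup>-\<^sup>1\<^sup>/\<^sup>2\<close>.
\<close>

lemma sa_square_regularised_inverse_root:
  fixes q :: "'a::unital_cstar_algebra"
  assumes q: "sa_square q" and \<epsilon>: "\<epsilon> > 0"
  obtains m where "star m = m" "m * q * m = 1 - \<epsilon> *\<^sub>R (m * m)" "q * m = m * q"
    "\<epsilon> * norm (m * m) \<le> 1"
proof -
  have "sa_square (of_real \<epsilon> :: 'a)"
    using \<epsilon> by (intro sa_squareI[where N=\<epsilon>]) simp_all
  hence "sa_square (q + of_real \<epsilon>)" using q sa_square_add by blast
  then obtain s where s: "sa_square s" "s * s = q + of_real \<epsilon>"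
    "\<And>z. z * (q + of_real \<epsilon>) = (q + of_real \<epsilon>) * z \<Longrightarrow> z * s = s * z"
    using sa_square_root by blast
  obtain g where g: "two_sided_inverse (q + of_real \<epsilon>) g" "\<epsilon> * norm g \<le> 1"
    using sa_square_resolvent[OF q \<epsilon>] by blast
  have g1: "g * (s * s) = 1" "s * s * g = 1" using g(1) by (simp_all add: two_sided_inverse_def s)
  have gs: "g * s = s * g" using s(3)[of g] g(1) by (simp add: two_sided_inverse_def)
  have sg: "star g = g"
    using two_sided_inverse_selfadjoint[OF g(1)] q by (simp add: star_add sa_square_selfadjoint)
  define m where "m = s * g"
  have ms: "m * s = 1" "s * m = 1"
    using g1 gs by (simp_all add: m_def mult.assoc)
  have mm: "m * m = g"
    using ms(1) by (metis gs m_def mult.assoc mult_1_left)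
  have qs: "q = s * s - of_real \<epsilon>" using s(2) by simp
  have mss: "m * (s * s) = s" "s * s * m = s"
    using ms by (metis mult.assoc mult_1_left, metis mult.assoc mult_1_right)
  show ?thesis
  proof
    show "star m = m" using s(1) by (simp add: m_def star_mult sg gs sa_square_selfadjoint)
    have "m * q * m = (m * (s * s)) * m - \<epsilon> *\<^sub>R (m * m)"
      by (simp add: qs algebra_simps of_real_def)
    thus "m * q * m = 1 - \<epsilon> *\<^sub>R (m * m)" by (simp add: mss ms)
    show "q * m = m * q" unfolding qs by (simp add: left_diff_distrib right_diff_distrib mss of_real_commute)
    show "\<epsilon> * norm (m * m) \<le> 1" using g(2) mm by simp
  qed
qed

text \<open>
  The element \<open>m\<close> is an approximate inverse of \<open>|u\<^sup>*|\<close> for \<open>u = x e\<close>, so \<open>m u u\<^sup>* m\<close> acts nearly as the identity on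
  \<open>u\<close>, hence on everything close to the right ideal generated by \<open>u\<close>, in particular on \<open>d\<^sup>2\<close>, and by the
  C*-identity on \<open>d\<close>.
\<close>

lemma compression_approx:
  fixes d e x y :: "'a::unital_cstar_algebra"
  assumes d: "star d = d" and e: "star e = e"
    and close: "norm (d * d - x * (e * e) * y) \<le> \<eta>" and \<eta>: "\<eta> > 0"
  obtains m where
    "norm (d * d - (d * m * x) * (e * e) * star (d * m * x)) \<le> norm d * sqrt (2 * \<eta>)"
proof -
  define u where "u = x * e"
  define L where "L = norm (e * y) + 1"
  have L: "L > 0" by (simp add: L_def add_nonneg_pos)
  \<comment> \<open>Chosen so that the bound \<open>\<parallel>z u\<parallel>\<^sup>2 \<le> 2\<epsilon>\<close> below becomes \<open>\<parallel>z u\<parallel> \<parallel>e y\<parallel> \<le> \<eta>\<close>.\<close>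
  define \<epsilon> where "\<epsilon> = (\<eta> / L)\<^sup>2 / 2"
  have \<epsilon>: "\<epsilon> > 0" using \<eta> L by (simp add: \<epsilon>_def)
  obtain m where m: "star m = m" "m * (u * star u) * m = 1 - \<epsilon> *\<^sub>R (m * m)"
      "u * star u * m = m * (u * star u)" "\<epsilon> * norm (m * m) \<le> 1"
    using sa_square_regularised_inverse_root[OF sa_square_mult_star \<epsilon>] by blast
  define z where "z = \<epsilon> *\<^sub>R (m * m)"
  have nz: "norm z \<le> 1" using m(4) \<epsilon> by (simp add: z_def)
  have sz: "star z = z" by (simp add: z_def star_scaleR star_mult m)
  have "z * (u * star u) * z = \<epsilon> *\<^sub>R ((m * (u * star u) * m) * z)"
  proof -
    have "m * (m * (u * star u)) = m * (u * star u) * m" using m(3) by (simp add: mult.assoc)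
    thus ?thesis by (simp add: z_def mult.assoc[symmetric])
  qed
  hence "norm (z * (u * star u) * z) = \<epsilon> * norm (z - z * z)"
    using \<epsilon> by (simp add: m(2) left_diff_distrib flip: z_def)
  also have "\<dots> \<le> \<epsilon> * 2"
  proof -
    have "norm (z * z) \<le> 1" using nz by (simp add: norm_square_selfadjoint sz power_le_one)
    thus ?thesis using \<epsilon> nz norm_triangle_ineq4[of z "z * z"] by simp
  qed
  also have "z * (u * star u) * z = (z * u) * star (z * u)"
    by (simp add: star_mult sz mult.assoc)
  finally have "(norm (z * u))\<^sup>2 \<le> (\<eta> / L)\<^sup>2" by (simp add: cstar_identity' \<epsilon>_def)
  hence nzu: "norm (z * u) \<le> \<eta> / L"
    using \<eta> L by (intro power2_le_imp_le[of "norm (z * u)"]) auto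
  have "z * (d * d) = z * (d * d - x * (e * e) * y) + (z * u) * (e * y)"
    by (simp add: u_def algebra_simps)
  moreover have "norm (z * (d * d - x * (e * e) * y)) \<le> 1 * \<eta>"
    using nz close by (intro order_trans[OF norm_mult_ineq] mult_mono) auto
  moreover have "norm ((z * u) * (e * y)) \<le> \<eta> / L * L"
    using nzu \<eta> L
    by (intro order_trans[OF norm_mult_ineq[of "z * u" "e * y"]] mult_mono) (auto simp: L_def)
  ultimately have "norm (z * (d * d)) \<le> 1 * \<eta> + \<eta> / L * L"
    using norm_triangle_mono by metis
  hence le: "norm (z * (d * d)) \<le> 2 * \<eta>" using L by simp
  have "(norm (z * d))\<^sup>2 = norm (z * (d * d) * z)"
    by (simp flip: cstar_identity' add: star_mult d sz mult.assoc)
  also have "\<dots> \<le> 2 * \<eta> * 1"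
    using le nz \<eta> by (intro order_trans[OF norm_mult_ineq[of "z * (d * d)" z]] mult_mono) auto
  finally have "norm (z * d) \<le> sqrt (2 * \<eta>)" by (simp add: real_le_rsqrt)
  hence "norm (d * (z * d)) \<le> norm d * sqrt (2 * \<eta>)"
    by (intro order_trans[OF norm_mult_ineq[of d "z * d"]] mult_left_mono) auto
  moreover have "d * (z * d) = d * d - (d * m * x) * (e * e) * star (d * m * x)"
  proof -
    have "(d * m * x) * (e * e) * star (d * m * x) = d * (m * (u * star u) * m) * d"
      by (simp add: u_def star_mult m d e mult.assoc)
    thus ?thesis unfolding m(2) by (simp add: z_def algebra_simps)
  qed
  ultimately show ?thesis using that by metis
qed



section \<open>The unitization\<close>

lemma bounded_linear_unitization_action:
  "bounded_linear (\<lambda>x. a * x + c *\<^sub>C (x::'a::cstar_algebra))"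
proof (rule bounded_linear_intro)
  fix x y :: 'a and r :: real
  show "a * (x + y) + c *\<^sub>C (x + y) = a * x + c *\<^sub>C x + (a * y + c *\<^sub>C y)"
    by (simp add: distrib_left scaleC_add_right)
  show "a * (r *\<^sub>R x) + c *\<^sub>C (r *\<^sub>R x) = r *\<^sub>R (a * x + c *\<^sub>C x)"
    by (simp add: scaleR_add_right scaleC_scaleC mult_scaleC_right scaleC_add_right mult.commute
        flip: scaleC_of_real)
  show "norm (a * x + c *\<^sub>C x) \<le> norm x * (norm a + cmod c)"
  proof -
    have "norm (a * x + c *\<^sub>C x) \<le> norm a * norm x + cmod c * norm x"
      by (intro norm_triangle_mono norm_mult_ineq) (simp add: norm_scaleC)
    thus ?thesis by (simp add: algebra_simps)
  qed
qed

text \<open>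
  \<open>Unitization a c\<close> stands for \<open>a + c1\<close>. It acts on \<open>A\<close> by left multiplication, and the operator norm of
  this action satisfies the C*-identity. If \<open>A\<close> already has a unit, the action is not faithful, so the
  norm is taken to be the maximum of the operator norm and the modulus of the scalar part: the latter
  is the norm of the quotient \<open>\<complex>\<close> and the former is faithful on \<open>A\<close>.
\<close>

datatype 'a unitization = Unitization (alg_part: 'a) (scal_part: complex)

definition left_action :: "'a::cstar_algebra unitization \<Rightarrow> 'a \<Rightarrow>\<^sub>L 'a" where
  "left_action p = Blinfun (\<lambda>x. alg_part p * x + scal_part p *\<^sub>C x)"

lemma left_action_apply [simp]:
  "blinfun_apply (left_action p) x = alg_part p * x + scal_part p *\<^sub>C x"
  by (simp add: left_action_def bounded_linear_Blinfun_apply bounded_linear_unitization_action)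

instantiation unitization :: (cstar_algebra) real_vector
begin

definition "0 = Unitization 0 0"
definition "p + q = Unitization (alg_part p + alg_part q) (scal_part p + scal_part q)"
definition "p - q = Unitization (alg_part p - alg_part q) (scal_part p - scal_part q)"
definition "- p = Unitization (- alg_part p) (- scal_part p)"
definition "r *\<^sub>R p = Unitization (r *\<^sub>R alg_part p) (r *\<^sub>R scal_part p)"

lemma unitization_sel [simp]:
  "alg_part (0::'a unitization) = 0" "scal_part (0::'a unitization) = 0"
  "alg_part (p + q) = alg_part p + alg_part q" "scal_part (p + q) = scal_part p + scal_part q"
  "alg_part (p - q) = alg_part p - alg_part q" "scal_part (p - q) = scal_part p - scal_part q"
  "alg_part (- p) = - alg_part p" "scal_part (- p) = - scal_part p"
  "alg_part (r *\<^sub>R p) = r *\<^sub>R alg_part p" "scal_part (r *\<^sub>R p) = r *\<^sub>R scal_part p"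
  by (simp_all add: zero_unitization_def plus_unitization_def minus_unitization_def
      uminus_unitization_def scaleR_unitization_def)

instance
  by standard (rule unitization.expand; simp add: scaleR_add_right scaleR_add_left)+

end

lemma left_action_add: "left_action (p + q) = left_action p + left_action q"
  by (rule blinfun_eqI) (simp add: blinfun.add_left algebra_simps scaleC_add_left)

lemma left_action_scaleR: "left_action (r *\<^sub>R p) = r *\<^sub>R left_action p"
  by (rule blinfun_eqI)
    (simp add: blinfun.scaleR_left scaleR_add_right scaleR_conv_of_real
      scaleC_scaleC[symmetric] scaleC_of_real)

lemma left_action_injective:
  assumes "left_action p = 0" "scal_part p = 0"
  shows "p = 0"
proof -
  have "alg_part p * star (alg_part p) = 0"
    using assms left_action_apply[of p "star (alg_part p)"] by simp
  hence "alg_part p = 0" using cstar_identity'[of "alg_part p"] by simp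
  thus ?thesis using assms by (simp add: unitization.expand)
qed

instantiation unitization :: (cstar_algebra) real_normed_vector
begin

definition "norm p = max (norm (left_action p)) (cmod (scal_part p))"
definition "dist p q = norm (p - q :: 'a unitization)"
definition "sgn p = inverse (norm p) *\<^sub>R (p :: 'a unitization)"
definition "uniformity =
  (INF e\<in>{0<..}. principal {(p, q). dist p q < (e::real)} :: ('a unitization \<times> 'a unitization) filter)"
definition "open (S :: 'a unitization set) \<longleftrightarrow> (\<forall>p\<in>S. \<forall>\<^sub>F (p', q) in uniformity. p' = p \<longrightarrow> q \<in> S)"

instance
proof
  fix p q :: "'a unitization" and s :: real
  show "dist p q = norm (p - q)" by (rule dist_unitization_def)
  show "sgn p = p /\<^sub>R norm p" by (rule sgn_unitization_def)
  show "norm p = 0 \<longleftrightarrow> p = 0"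
  proof
    assume "norm p = 0"
    hence "norm (left_action p) = 0" "cmod (scal_part p) = 0"
      using norm_ge_zero[of "left_action p"] norm_ge_zero[of "scal_part p"]
      unfolding norm_unitization_def max_def by (auto split: if_splits)
    thus "p = 0" by (intro left_action_injective) simp_all
  next
    assume "p = 0"
    moreover have "left_action (0::'a unitization) = 0" by (rule blinfun_eqI) simp
    ultimately show "norm p = 0" by (simp add: norm_unitization_def)
  qed
  have "norm (left_action p + left_action q) \<le> norm (left_action p) + norm (left_action q)"
    "cmod (scal_part p + scal_part q) \<le> cmod (scal_part p) + cmod (scal_part q)"
    by (rule norm_triangle_ineq)+
  thus "norm (p + q) \<le> norm p + norm q"
    unfolding norm_unitization_def left_action_add unitization_sel by linarith
  show "norm (s *\<^sub>R p) = \<bar>s\<bar> * norm p"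
    by (simp add: norm_unitization_def left_action_scaleR max_mult_distrib_left)
qed (rule uniformity_unitization_def open_unitization_def)+

end

lemma norm_left_action_le: "norm (alg_part p * x + scal_part p *\<^sub>C x) \<le> norm p * norm x"
proof -
  have "norm (blinfun_apply (left_action p) x) \<le> norm (left_action p) * norm x"
    by (rule norm_blinfun)
  also have "\<dots> \<le> norm p * norm x"
    by (intro mult_right_mono) (simp_all add: norm_unitization_def)
  finally show ?thesis by simp
qed

lemma cmod_scal_part_le: "cmod (scal_part p) \<le> norm p"
  by (simp add: norm_unitization_def)

lemma norm_unitization_leI:
  assumes "\<And>x. norm (alg_part p * x + scal_part p *\<^sub>C x) \<le> K * norm x"
    "cmod (scal_part p) \<le> K"
  shows "norm p \<le> K"
proof -
  have "K \<ge> 0" using assms(2) norm_ge_zero order_trans by blast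
  hence "norm (left_action p) \<le> K" using assms(1) by (intro norm_blinfun_bound) simp_all
  thus ?thesis using assms(2) by (simp add: norm_unitization_def)
qed

lemma norm_Unitization_alg [simp]: "norm (Unitization a 0) = norm a"
proof (rule antisym)
  show "norm (Unitization a 0) \<le> norm a"
    by (rule norm_unitization_leI) (simp_all add: norm_mult_ineq)
  have "norm a * norm a = norm (a * star a)" by (simp add: cstar_identity' power2_eq_square)
  also have "\<dots> \<le> norm (Unitization a 0) * norm a"
    using norm_left_action_le[of "Unitization a 0" "star a"] by simp
  finally have "norm a * norm a \<le> norm (Unitization a 0) * norm a" .
  thus "norm a \<le> norm (Unitization a 0)" by (cases "a = 0") auto
qed

instance unitization :: (cstar_algebra) banach
proof
  fix X :: "nat \<Rightarrow> 'a unitization"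
  assume X: "Cauchy X"
  have "Cauchy (\<lambda>n. scal_part (X n))"
  proof (rule CauchyI)
    fix e :: real assume "e > 0"
    with CauchyD[OF X] show "\<exists>M. \<forall>m\<ge>M. \<forall>n\<ge>M. norm (scal_part (X m) - scal_part (X n)) < e"
      by (metis cmod_scal_part_le order_le_less_trans unitization_sel(6))
  qed
  moreover have "Cauchy (\<lambda>n. alg_part (X n))"
  proof (rule CauchyI)
    fix e :: real assume e: "e > 0"
    obtain M where M: "\<And>m n. m \<ge> M \<Longrightarrow> n \<ge> M \<Longrightarrow> norm (X m - X n) < e / 2"
      using CauchyD[OF X, of "e / 2"] e by auto
    have "norm (alg_part p) \<le> 2 * norm p" for p :: "'a unitization"
    proof -
      have "norm (Unitization (0::'a) c) \<le> cmod c" for c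
        by (rule norm_unitization_leI) (simp_all add: norm_scaleC)
      hence "norm (Unitization (0::'a) (scal_part p)) \<le> norm p"
        using cmod_scal_part_le order_trans by blast
      moreover have "Unitization (alg_part p) 0 = p - Unitization 0 (scal_part p)"
        by (rule unitization.expand) simp
      hence "norm (alg_part p) \<le> norm p + norm (Unitization (0::'a) (scal_part p))"
        by (metis norm_Unitization_alg norm_triangle_ineq4)
      ultimately show ?thesis by simp
    qed
    hence le: "norm (alg_part (X m) - alg_part (X n)) \<le> 2 * norm (X m - X n)" for m n
      by (metis unitization_sel(5))
    have "norm (alg_part (X m) - alg_part (X n)) < e" if "m \<ge> M" "n \<ge> M" for m n
      using le[of m n] M[OF that] by simp
    thus "\<exists>M. \<forall>m\<ge>M. \<forall>n\<ge>M. norm (alg_part (X m) - alg_part (X n)) < e" by blast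
  qed
  ultimately obtain a c where ac: "(\<lambda>n. alg_part (X n)) \<longlonglongrightarrow> a" "(\<lambda>n. scal_part (X n)) \<longlonglongrightarrow> c"
    by (auto simp: Cauchy_convergent_iff convergent_def)
  have "X \<longlonglongrightarrow> Unitization a c"
  proof (rule Lim_null_comparison[THEN LIM_zero_cancel])
    show "(\<lambda>n. norm (alg_part (X n) - a) + cmod (scal_part (X n) - c)) \<longlonglongrightarrow> 0"
      using tendsto_add[OF tendsto_norm_zero[OF LIM_zero[OF ac(1)]]
          tendsto_norm_zero[OF LIM_zero[OF ac(2)]]] by simp
    have "norm p \<le> norm (alg_part p) + cmod (scal_part p)" for p :: "'a unitization"
    proof (rule norm_unitization_leI)
      fix x
      have "norm (alg_part p * x + scal_part p *\<^sub>C x) \<le> norm (alg_part p) * norm x + cmod (scal_part p) * norm x"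
        by (intro norm_triangle_mono norm_mult_ineq) (simp add: norm_scaleC)
      thus "norm (alg_part p * x + scal_part p *\<^sub>C x) \<le> (norm (alg_part p) + cmod (scal_part p)) * norm x"
        by (simp add: distrib_right)
    qed simp
    from this[of "X n - Unitization a c" for n]
    show "\<forall>\<^sub>F n in sequentially. norm (X n - Unitization a c)
            \<le> norm (alg_part (X n) - a) + cmod (scal_part (X n) - c)"
      by simp
  qed
  thus "convergent X" by (auto simp: convergent_def)
qed

instantiation unitization :: (cstar_algebra) unital_cstar_algebra
begin

definition "1 = Unitization 0 1"
definition "p * q = Unitization
  (alg_part p * alg_part q + scal_part p *\<^sub>C alg_part q + scal_part q *\<^sub>C alg_part p)
  (scal_part p * scal_part q)"
definition "c *\<^sub>C p = Unitization (c *\<^sub>C alg_part p) (c * scal_part p)"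
definition "star p = Unitization (star (alg_part p)) (cnj (scal_part p))"

lemma unitization_mult_sel [simp]:
  "alg_part (1::'a unitization) = 0" "scal_part (1::'a unitization) = 1"
  "alg_part (p * q) =
     alg_part p * alg_part q + scal_part p *\<^sub>C alg_part q + scal_part q *\<^sub>C alg_part p"
  "scal_part (p * q) = scal_part p * scal_part q"
  "alg_part (c *\<^sub>C p) = c *\<^sub>C alg_part p" "scal_part (c *\<^sub>C p) = c * scal_part p"
  "alg_part (star p) = star (alg_part p)" "scal_part (star p) = cnj (scal_part p)"
  by (simp_all add: one_unitization_def times_unitization_def scaleC_unitization_def
      star_unitization_def)

lemma left_action_mult: 
  "blinfun_apply (left_action (p * q)) x = blinfun_apply (left_action p) (blinfun_apply (left_action q) x)"
  by (simp add: distrib_left distrib_right scaleC_add_right mult_scaleC_left mult_scaleC_right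
      scaleC_scaleC mult.assoc add_ac)

text \<open>
  Apply the C*-identity of \<open>A\<close> to the vector \<open>p x\<close>: \<open>\<parallel>p x\<parallel>\<^sup>2 = \<parallel>x\<^sup>* (p\<^sup>* p x)\<parallel>\<close>.
\<close>

lemma norm_left_action_star_mult:
  "(norm (left_action p))\<^sup>2 \<le> norm (left_action (star p * p))"
proof -
  let ?K = "norm (left_action (star p * p))"
  have "norm (blinfun_apply (left_action p) x) \<le> sqrt ?K * norm x" for x
  proof -
    let ?y = "blinfun_apply (left_action p) x"
    have "star ?y * ?y = star x * blinfun_apply (left_action (star p * p)) x"
      unfolding left_action_mult
      by (simp add: star_add star_mult star_scaleC distrib_left distrib_right
          scaleC_add_right mult_scaleC_left mult_scaleC_right scaleC_scaleC mult.assoc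
          mult.commute[of "scal_part p"])
    hence "(norm ?y)\<^sup>2 = norm (star x * blinfun_apply (left_action (star p * p)) x)"
      by (simp only: cstar_identity[symmetric])
    also have "\<dots> \<le> norm x * (?K * norm x)"
      by (intro order_trans[OF norm_mult_ineq] mult_mono norm_blinfun) auto
    also have "\<dots> = (sqrt ?K * norm x)\<^sup>2" by (simp add: power2_eq_square algebra_simps)
    finally show ?thesis by (rule power2_le_imp_le) simp
  qed
  hence "norm (left_action p) \<le> sqrt ?K" by (intro norm_blinfun_bound) simp_all
  thus ?thesis by (metis norm_ge_zero real_sqrt_pow2 power_mono)
qed

lemma norm_left_action_mult: "norm (left_action (p * q)) \<le> norm (left_action p) * norm (left_action q)"
proof (rule norm_blinfun_bound)
  fix x
  show "norm (blinfun_apply (left_action (p * q)) x) \<le> norm (left_action p) * norm (left_action q) * norm x"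
    unfolding left_action_mult mult.assoc
    by (rule order_trans[OF norm_blinfun]) (intro mult_left_mono norm_blinfun norm_ge_zero)
qed simp

lemma norm_left_action_star:
  "norm (left_action (star p * p)) = (norm (left_action p))\<^sup>2"
proof -
  have *: "norm (left_action p) \<le> norm (left_action (star p))" for p :: "'a unitization"
  proof (cases "norm (left_action p) = 0")
    case False
    have "norm (left_action p) * norm (left_action p) \<le> norm (left_action (star p)) * norm (left_action p)"
      using norm_left_action_star_mult[of p] norm_left_action_mult[of "star p" p]
      by (simp add: power2_eq_square)
    thus ?thesis using False by simp
  qed simp
  have "star (star p) = p" by (rule unitization.expand) (simp add: star_star)
  hence "norm (left_action (star p)) = norm (left_action p)" using *[of p] *[of "star p"] by simp
  hence "norm (left_action (star p * p)) \<le> (norm (left_action p))\<^sup>2"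
    using norm_left_action_mult[of "star p" p] by (simp add: power2_eq_square)
  thus ?thesis using norm_left_action_star_mult[of p] by simp
qed

instance
proof
  fix p q r :: "'a unitization" and s :: real and c d :: complex
  show "(p * q) * r = p * (q * r)"
    by (rule unitization.expand)
      (simp add: distrib_left distrib_right scaleC_add_right mult_scaleC_left mult_scaleC_right
        scaleC_scaleC mult_ac add_ac mult.assoc)
  show "(p + q) * r = p * r + q * r" "p * (q + r) = p * q + p * r"
    by (rule unitization.expand; simp add: distrib_left distrib_right scaleC_add_right
        scaleC_add_left)+
  show "1 * p = p" "p * 1 = p" by (rule unitization.expand; simp)+
  show "(0::'a unitization) \<noteq> 1" by (metis unitization_mult_sel(2) unitization_sel(2) zero_neq_one)
  show "s *\<^sub>R p * q = s *\<^sub>R (p * q)" "p * s *\<^sub>R q = s *\<^sub>R (p * q)"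
    by (rule unitization.expand; simp add: scaleC_add_right scaleC_scaleC
        mult_scaleC_left mult_scaleC_right mult_ac scaleR_conv_of_real flip: scaleC_of_real)+
  show "complex_of_real s *\<^sub>C p = s *\<^sub>R p"
    by (rule unitization.expand) (simp add: scaleC_of_real scaleR_conv_of_real)
  show "c *\<^sub>C (p + q) = c *\<^sub>C p + c *\<^sub>C q" "(c + d) *\<^sub>C p = c *\<^sub>C p + d *\<^sub>C p"
    "c *\<^sub>C d *\<^sub>C p = (c * d) *\<^sub>C p" 
    by (rule unitization.expand; simp add: scaleC_add_right scaleC_add_left scaleC_scaleC
        distrib_left distrib_right)+
  show "c *\<^sub>C p * q = c *\<^sub>C (p * q)" "p * c *\<^sub>C q = c *\<^sub>C (p * q)"
    by (rule unitization.expand; simp add: scaleC_add_right scaleC_scaleC mult_scaleC_left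
        mult_scaleC_right mult_ac)+
  show "star (p + q) = star p + star q" "star (c *\<^sub>C p) = cnj c *\<^sub>C star p"
    "star (p * q) = star q * star p" "star (star p) = p"
    by (rule unitization.expand; simp add: star_add star_scaleC star_mult star_star)+
  have nle: "norm (c *\<^sub>C p) \<le> cmod c * norm p" for c and p :: "'a unitization"
  proof (rule norm_unitization_leI)
    fix x
    have "alg_part (c *\<^sub>C p) * x + scal_part (c *\<^sub>C p) *\<^sub>C x = c *\<^sub>C (alg_part p * x + scal_part p *\<^sub>C x)"
      by (simp add: scaleC_add_right scaleC_scaleC mult_scaleC_left)
    thus "norm (alg_part (c *\<^sub>C p) * x + scal_part (c *\<^sub>C p) *\<^sub>C x) \<le> cmod c * norm p * norm x"
      using norm_left_action_le[of p x] by (simp add: norm_scaleC mult.assoc mult_left_mono)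
  next
    show "cmod (scal_part (c *\<^sub>C p)) \<le> cmod c * norm p"
      by (simp add: norm_mult mult_left_mono cmod_scal_part_le)
  qed
  show "norm (c *\<^sub>C p) = cmod c * norm p"
  proof (cases "c = 0")
    case True
    thus ?thesis using nle[of c p] by simp
  next
    case False
    have "inverse c *\<^sub>C (c *\<^sub>C p) = p"
      by (rule unitization.expand) (use False in \<open>simp add: scaleC_scaleC\<close>)
    hence "norm p \<le> inverse (cmod c) * norm (c *\<^sub>C p)"
      using nle[of "inverse c" "c *\<^sub>C p"] by (simp add: norm_inverse)
    hence "cmod c * norm p \<le> norm (c *\<^sub>C p)" using False by (simp add: field_simps)
    thus ?thesis using nle[of c p] by simp
  qed
  show "norm (p * q) \<le> norm p * norm q"
    unfolding norm_unitization_def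
  proof (rule max.boundedI)
    show "norm (left_action (p * q)) \<le> max (norm (left_action p)) (cmod (scal_part p)) *
        max (norm (left_action q)) (cmod (scal_part q))"
      by (rule order_trans[OF norm_left_action_mult]) (rule mult_mono; simp add: le_max_iff_disj)
    show "cmod (scal_part (p * q)) \<le> max (norm (left_action p)) (cmod (scal_part p)) *
        max (norm (left_action q)) (cmod (scal_part q))"
      unfolding unitization_mult_sel norm_mult by (rule mult_mono; simp add: le_max_iff_disj)
  qed
  show "norm (star p * p) = (norm p)\<^sup>2"
  proof -
    have "max (x\<^sup>2) (y\<^sup>2) = (max x y)\<^sup>2" if "x \<ge> 0" "y \<ge> 0" for x y :: real
      using that by (simp add: max_def)
    moreover have "cmod (scal_part (star p * p)) = (cmod (scal_part p))\<^sup>2"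
      by (simp add: norm_mult power2_eq_square)
    ultimately show ?thesis unfolding norm_unitization_def norm_left_action_star by simp
  qed
  show "norm (1::'a unitization) = 1"
  proof (rule antisym)
    show "norm (1::'a unitization) \<le> 1" by (rule norm_unitization_leI) simp_all
    show "1 \<le> norm (1::'a unitization)" using cmod_scal_part_le[of "1::'a unitization"] by simp
  qed
qed

end

lemma Unitization_mult_conv:
  "Unitization a c * Unitization b d =
     (case unitization_mult (a, c) (b, d) of (x, y) \<Rightarrow> Unitization x y)"
  by (simp add: times_unitization_def unitization_mult_def)

lemma Unitization_add_of_real: "Unitization a 0 + of_real t = Unitization a (complex_of_real t)"
  by (rule unitization.expand) (simp add: of_real_def)

lemma positive_imp_sa_square:
  assumes "positive a"
  shows "sa_square (Unitization a 0)"
proof (rule sa_square_of_resolvents)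
  show "star (Unitization a 0) = Unitization a 0"
    using assms by (intro unitization.expand) (simp add: positive_def)
  fix t :: real assume t: "t > 0"
  have "complex_of_real (- t) \<notin> spectrum a"
    using assms t by (auto simp: positive_def complex_nonneg_Reals_iff)
  then obtain q where q: "unitization_mult (a, complex_of_real t) q = (0, 1)"
      "unitization_mult q (a, complex_of_real t) = (0, 1)"
    by (auto simp: spectrum_def)
  have "two_sided_inverse (Unitization a 0 + of_real t) (Unitization (fst q) (snd q))"
    unfolding two_sided_inverse_def Unitization_add_of_real Unitization_mult_conv prod.collapse q
    by (simp add: one_unitization_def)
  thus "\<exists>g. two_sided_inverse (Unitization a 0 + of_real t) g" by blast
qed

text \<open>
  A root \<open>s\<close> exists in the unitization. The scalar part of \<open>s\<^sup>2\<close> is 0, so that of \<open>s\<close> is 0, too, and the root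
  lies in \<open>A\<close>.
\<close>

lemma positive_square_root:
  assumes "positive a"
  obtains e where "star e = e" "a = e * e"
proof -
  obtain s where s: "star s = s" "Unitization a 0 = s * s"
    using positive_imp_sa_square[OF assms] by (auto simp: sa_square_def)
  have "scal_part s * scal_part s = 0" using arg_cong[OF s(2), of scal_part] by simp
  hence "scal_part s = 0" by simp
  moreover from this have "a = alg_part s * alg_part s" using arg_cong[OF s(2), of alg_part] by simp
  moreover have "star (alg_part s) = alg_part s" using arg_cong[OF s(1), of alg_part] by simp
  ultimately show ?thesis using that by blast
qed


section \<open>Cuntz comparison\<close>

lemma cuntz_le_imp_closure:
  assumes "b \<precsim> a"
  shows "b \<in> closure (principal_sums a)"
proof -
  obtain x where x: "(\<lambda>i. x i * a * star (x i)) \<longlonglongrightarrow> b" using assms by (auto simp: cuntz_le_def)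
  have "x i * a * star (x i) \<in> principal_sums a" for i
    unfolding principal_sums_def
    by (rule CollectI, rule exI[of _ 1], rule exI[of _ "\<lambda>_. x i"], rule exI[of _ "\<lambda>_. star (x i)"]) simp
  with x have "\<exists>f. (\<forall>n. f n \<in> principal_sums a) \<and> f \<longlonglongrightarrow> b"
    by (intro exI[of _ "\<lambda>i. x i * a * star (x i)"]) simp
  thus ?thesis by (simp add: closure_sequential)
qed

lemma cuntz_le_if_approx:
  fixes a b :: "'a::cstar_algebra"
  assumes a: "positive a" and b: "positive b"
    and approx: "\<And>\<eta>. \<eta> > 0 \<Longrightarrow> \<exists>x y. norm (b - x * a * y) \<le> \<eta>"
  shows "b \<precsim> a"
proof -
  obtain e where e: "star e = e" "a = e * e" using positive_square_root[OF a] .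
  obtain d where d: "star d = d" "b = d * d" using positive_square_root[OF b] .
  have "\<exists>w. norm (b - w * a * star w) < \<delta>" if \<delta>: "\<delta> > 0" for \<delta>
  proof -
    \<comment> \<open>Solves \<open>(\<parallel>d\<parallel> + 1) \<surd>(2\<eta>) = \<delta>\<close>.\<close>
    define \<eta> where "\<eta> = (\<delta> / (norm d + 1))\<^sup>2 / 2"
    have n1: "norm d + 1 > 0" by (simp add: add_nonneg_pos)
    have \<eta>: "\<eta> > 0" using \<delta> n1 by (simp add: \<eta>_def)
    obtain x y where xy: "norm (b - x * a * y) \<le> \<eta>" using approx[OF \<eta>] by blast
    let ?U = "\<lambda>z::'a. Unitization z 0"
    have U: "star (?U z) = ?U (star z)" "?U z * ?U z' = ?U (z * z')" "?U z - ?U z' = ?U (z - z')" for z z'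
      by (rule unitization.expand; simp)+
    obtain m where m: "norm (?U d * ?U d - ?U d * m * ?U x * (?U e * ?U e) * star (?U d * m * ?U x))
        \<le> norm (?U d) * sqrt (2 * \<eta>)"
      using compression_approx[of "?U d" "?U e" "?U x" "?U y" \<eta>] xy \<eta>
      by (auto simp: U d e)
    \<comment> \<open>Since \<open>d\<close> lies in the ideal \<open>A\<close> of the unitization, so does \<open>d m x\<close>.\<close>
    define w where "w = alg_part (?U d * m * ?U x)"
    have "?U d * m * ?U x = ?U w" by (rule unitization.expand) (simp add: w_def)
    with m have "norm (b - w * a * star w) \<le> norm d * sqrt (2 * \<eta>)"
      by (simp add: U d(2)[symmetric] e(2)[symmetric])
    also have "sqrt (2 * \<eta>) = \<delta> / (norm d + 1)" using \<delta> n1 by (simp add: \<eta>_def)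
    also have "norm d * (\<delta> / (norm d + 1)) < \<delta>" using \<delta> n1 by (simp add: field_simps)
    finally show ?thesis by blast
  qed
  hence "\<forall>n. \<exists>w. norm (b - w * a * star w) < inverse (Suc n)" by simp
  then obtain w where w: "\<And>n. norm (b - w n * a * star (w n)) < inverse (Suc n)" by metis
  have "(\<lambda>n. w n * a * star (w n)) \<longlonglongrightarrow> b"
  proof (rule Lim_null_comparison[THEN LIM_zero_cancel])
    show "(\<lambda>n. inverse (real (Suc n))) \<longlonglongrightarrow> 0" by (rule LIMSEQ_inverse_real_of_nat)
    show "\<forall>\<^sub>F n in sequentially. norm (w n * a * star (w n) - b) \<le> inverse (real (Suc n))"
      using w by (intro always_eventually) (auto simp: norm_minus_commute intro: less_imp_le)
  qed
  thus ?thesis by (auto simp: cuntz_le_def)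
qed


section \<open>Characters\<close>

text \<open>
  The cosets of the kernel are the fibres \<open>F c = h\<^sup>-\<^sup>1(c)\<close>, and \<open>F\<close> carries the operations of \<open>\<complex>\<close> to those of the
  quotient. The ring axioms and the units are therefore transported along \<open>F\<close> from \<open>\<complex>\<close>; they are not
  inherited from \<open>A\<close>, which need not have a unit.
\<close>

lemma character_kernel_quotient:
  fixes h :: "'a::cstar_algebra \<Rightarrow> complex"
  assumes "character h"
  shows "\<exists>I e. two_sided_ideal (I::'a set) \<and> division_ring (ring_record e Quot I)"
proof -
  have add: "h (x + y) = h x + h y" and sc: "h (c *\<^sub>C x) = c * h x"
    and mult: "h (x * y) = h x * h y" for x y c
    using assms by (auto simp: character_def)
  obtain x0 where x0: "h x0 \<noteq> 0" using assms by (auto simp: character_def)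
  have h0: "h 0 = 0" using add[of 0 0] by simp
  have diff: "h (x - y) = h x - h y" for x y using add[of "x - y" y] by simp
  have surj: "\<exists>x. h x = c" for c
    by (rule exI[of _ "(c / h x0) *\<^sub>C x0"]) (use x0 in \<open>simp add: sc\<close>)
  then obtain e where e: "h e = 1" by blast
  define F where "F c = {x. h x = c}" for c
  let ?I = "F 0"
  let ?Q = "ring_record e Quot ?I"
  have coset: "a_r_coset (ring_record e) ?I x = F (h x)" for x
  proof -
    have "a_r_coset (ring_record e) ?I x = (\<Union>i\<in>?I. {i + x})"
      by (simp add: a_r_coset_def r_coset_def ring_record_def)
    also have "\<dots> = F (h x)"
      by (auto simp: F_def add) (metis add_diff_cancel_right' diff diff_add_cancel eq_iff_diff_eq_0)
    finally show ?thesis .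
  qed
  have carrier: "carrier ?Q = range F"
  proof -
    have "carrier ?Q = range (\<lambda>x. a_r_coset (ring_record e) ?I x)"
      by (auto simp: FactRing_def A_RCOSETS_def' ring_record_def)
    thus ?thesis unfolding coset using surj by (auto simp: image_def) metis
  qed
  have mult_F: "F c \<otimes>\<^bsub>?Q\<^esub> F d = F (c * d)" for c d
  proof -
    have "F c \<otimes>\<^bsub>?Q\<^esub> F d = (\<Union>x\<in>F c. \<Union>y\<in>F d. F (h (x * y)))"
      unfolding coset[symmetric] by (simp add: FactRing_def rcoset_mult_def ring_record_def)
    also have "\<dots> = F (c * d)"
      using surj[of c] surj[of d] by (auto simp: F_def mult)
    finally show ?thesis .
  qed
  have add_F: "F c \<oplus>\<^bsub>?Q\<^esub> F d = F (c + d)" for c d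
  proof -
    have "F c \<oplus>\<^bsub>?Q\<^esub> F d = (\<Union>x\<in>F c. \<Union>y\<in>F d. {x + y})"
      by (simp add: FactRing_def set_add_def set_mult_def ring_record_def)
    also have "\<dots> = F (c + d)"
    proof -
      obtain x where "h x = c" using surj by blast
      hence "\<exists>u v. h u = c \<and> h v = d \<and> z = u + v" if "h z = c + d" for z
        using that by (intro exI[of _ x] exI[of _ "z - x"]) (simp add: diff)
      thus ?thesis by (auto simp: F_def add)
    qed
    finally show ?thesis .
  qed
  have one_F: "\<one>\<^bsub>?Q\<^esub> = F 1"
    using coset[of e] by (simp add: FactRing_def e) (simp add: ring_record_def)
  have zero_F: "\<zero>\<^bsub>?Q\<^esub> = F 0" by (simp add: FactRing_def)
  have inj: "F c = F d \<Longrightarrow> c = d" for c d using surj[of c] by (auto simp: F_def)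
  have "Ring.ring ?Q"
  proof (rule ringI)
    show "abelian_group ?Q"
    proof (rule abelian_groupI)
      fix A assume "A \<in> carrier ?Q"
      then obtain c where "A = F c" by (auto simp: carrier)
      hence "F (- c) \<oplus>\<^bsub>?Q\<^esub> A = \<zero>\<^bsub>?Q\<^esub>" by (simp add: add_F zero_F)
      thus "\<exists>B\<in>carrier ?Q. B \<oplus>\<^bsub>?Q\<^esub> A = \<zero>\<^bsub>?Q\<^esub>" by (auto simp: carrier)
    qed (auto simp: carrier add_F zero_F add_ac)
    show "Group.monoid ?Q"
      by (rule monoidI) (auto simp: carrier mult_F one_F mult_ac)
  qed (auto simp: carrier add_F mult_F algebra_simps)
  moreover have "Units ?Q = carrier ?Q - {\<zero>\<^bsub>?Q\<^esub>}"
  proof (rule Set.set_eqI)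
    fix A
    have "F c \<in> Units ?Q \<longleftrightarrow> c \<noteq> 0" for c
    proof
      assume "F c \<in> Units ?Q"
      then obtain d where "F (c * d) = F 1" by (auto simp: Units_def carrier mult_F one_F)
      thus "c \<noteq> 0" using inj[of "c * d" 1] by auto
    next
      assume "c \<noteq> 0"
      hence "F (inverse c) \<otimes>\<^bsub>?Q\<^esub> F c = \<one>\<^bsub>?Q\<^esub>" "F c \<otimes>\<^bsub>?Q\<^esub> F (inverse c) = \<one>\<^bsub>?Q\<^esub>"
        by (simp_all add: mult_F one_F)
      thus "F c \<in> Units ?Q" by (auto simp: Units_def carrier)
    qed
    moreover have "Units ?Q \<subseteq> range F" by (auto simp: Units_def carrier)
    ultimately show "A \<in> Units ?Q \<longleftrightarrow> A \<in> carrier ?Q - {\<zero>\<^bsub>?Q\<^esub>}"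
      unfolding carrier zero_F using inj by blast
  qed
  ultimately have "division_ring ?Q" by (simp add: division_ring_def)
  moreover have "two_sided_ideal ?I" by (simp add: two_sided_ideal_def F_def h0 diff mult)
  ultimately show ?thesis by blast
qed

theorem proposition3p16:
  assumes "purely_infinite_ring TYPE('a::cstar_algebra)"
  shows "purely_infinite_cstar TYPE('a)"
proof -
  have no_div: "\<nexists>(I::'a set) e. two_sided_ideal I \<and> division_ring (ring_record e Quot I)"
    and factor: "\<And>a b::'a. b \<in> principal_sums a \<Longrightarrow> \<exists>x y. b = x * a * y"
    using assms by (auto simp: purely_infinite_ring_def)
  have "b \<precsim> a" if ab: "positive a" "positive b" "b \<in> closure (principal_sums a)" for a b :: 'a
  proof (rule cuntz_le_if_approx[OF ab(1,2)])
    fix \<eta> :: real assume "\<eta> > 0"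
    then obtain c where "c \<in> principal_sums a" "dist c b < \<eta>"
      using ab(3) by (auto simp: closure_approachable)
    with factor show "\<exists>x y. norm (b - x * a * y) \<le> \<eta>"
      by (metis dist_commute dist_norm less_imp_le)
  qed
  thus ?thesis
    using no_div character_kernel_quotient cuntz_le_imp_closure
    unfolding purely_infinite_cstar_def by blast
qed

end
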